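(* Let $F$ be a gauge on $\mathbb{R}^2$ whose unit circle $S=\{x:F(x)=1\}$ is smooth and strictly convex, and let $\gamma(s)$ be an oriented smooth curve in $(\mathbb{R}^2,F)$ parametrized by arc length, $F(\gamma'(s))=1$. Let $k_m$ be its Minkowski curvature, $k_l$ its arc-length curvature, and $n_\gamma$ its right normal vector field. Then $$k_l(s)=F(n_\gamma(s))\,k_m(s)\quad\text{for all } s.$$
   Context: A gauge on $\mathbb{R}^2$ is a function $F:\mathbb{R}^2\to\mathbb{R}$ with $F(x)\ge 0$, $F(x)=0\Leftrightarrow x=0$; $F(\lambda x)=\lambda F(x)$ for $\lambda>0$; $F(x+y)\le F(x)+F(y)$ (no symmetry assumed). For $x=(x_1,x_2)$, $y=(y_1,y_2)$ put $[x,y]=x_1y_2-x_2y_1$. Minkowski curvature and right normal field: let $\varphi(t)$ be a counter-clockwise parametrization of $S$ with $[\varphi(t),\varphi'(t)]>0$, put $u(t)=\int_{t_0}^t[\varphi(\tau),\varphi'(\tau)]\,d\tau$, and reparametrize $S$ by $u$ as $\varphi(u)$ (so $[\varphi(u),\varphi'(u)]=1$). Write $\gamma'(s)=\varphi(u(s))$ with $u(s)$ continuous. Then $k_m(s):=u'(s)$ and $n_\gamma(s):=\varphi'(u(s))$. Arc-length curvature: let now $\varphi(t)$ denote a counter-clockwise parametrization of $S$ by $F$-arc length, $F(\varphi'(t))=1$. Write $\gamma'(s)=\varphi(\hat t(s))$ with $\hat t$ continuous. Then $k_l(s):=\hat t'(s)$. *)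

theory Defs
  imports "HOL-Analysis.Analysis"
begin

definition gauge_fun :: "(real^2 \<Rightarrow> real) \<Rightarrow> bool" where
  "gauge_fun F \<longleftrightarrow>
     (\<forall>x. 0 \<le> F x) \<and> (\<forall>x. F x = 0 \<longleftrightarrow> x = 0) \<and>
     (\<forall>c x. 0 < c \<longrightarrow> F (c *\<^sub>R x) = c * F x) \<and>
     (\<forall>x y. F (x + y) \<le> F x + F y)"

definition bracket :: "real^2 \<Rightarrow> real^2 \<Rightarrow> real" where
  "bracket x y = x $ 1 * y $ 2 - x $ 2 * y $ 1"

definition unit_circle :: "(real^2 \<Rightarrow> real) \<Rightarrow> (real^2) set" where
  "unit_circle F = {x. F x = 1}"

(* Regular closed curves are maps on the whole line, periodic and injective on one period,
   so that the parameter can be continued past a full turn. *)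
definition closed_parametrization :: "(real^2) set \<Rightarrow> (real \<Rightarrow> real^2) \<Rightarrow> bool" where
  "closed_parametrization C \<psi> \<longleftrightarrow>
     \<psi> C1_differentiable_on UNIV \<and> (\<forall>t. vector_derivative \<psi> (at t) \<noteq> 0) \<and> range \<psi> = C \<and>
     (\<exists>T>0. (\<forall>t. \<psi> (t + T) = \<psi> t) \<and> inj_on \<psi> {0..<T})"

definition smooth_closed_curve :: "(real^2) set \<Rightarrow> bool" where
  "smooth_closed_curve C \<longleftrightarrow> (\<exists>\<psi>. closed_parametrization C \<psi>)"

(* For the unit circle of a gauge, which bounds a convex set, this is strict convexity. *)
definition segment_free :: "(real^2) set \<Rightarrow> bool" where
  "segment_free C \<longleftrightarrow> (\<forall>x y. x \<noteq> y \<longrightarrow> \<not> closed_segment x y \<subseteq> C)"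

definition ccw_parametrization :: "(real^2 \<Rightarrow> real) \<Rightarrow> (real \<Rightarrow> real^2) \<Rightarrow> bool" where
  "ccw_parametrization F \<psi> \<longleftrightarrow>
     closed_parametrization (unit_circle F) \<psi> \<and>
     (\<forall>t. 0 < bracket (\<psi> t) (vector_derivative \<psi> (at t)))"

(* phi is psi reparametrized by u(t) = LBINT tau=t0..t. [psi(tau), psi'(tau)]; the interval
   integral is oriented, and u is onto the real line because psi is periodic, so the equation
   determines phi everywhere. *)
definition minkowski_parametrization :: "(real^2 \<Rightarrow> real) \<Rightarrow> (real \<Rightarrow> real^2) \<Rightarrow> bool" where
  "minkowski_parametrization F \<phi> \<longleftrightarrow>
     (\<exists>\<psi> t\<^sub>0. ccw_parametrization F \<psi> \<and>
       (\<forall>t. \<phi> (LBINT \<tau>=ereal t\<^sub>0..ereal t. bracket (\<psi> \<tau>) (vector_derivative \<psi> (at \<tau>))) = \<psi> t))"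

definition arc_length_parametrization :: "(real^2 \<Rightarrow> real) \<Rightarrow> (real \<Rightarrow> real^2) \<Rightarrow> bool" where
  "arc_length_parametrization F \<phi> \<longleftrightarrow>
     ccw_parametrization F \<phi> \<and> (\<forall>t. F (vector_derivative \<phi> (at t)) = 1)"

(* C^2, the least regularity for which gamma' has a derivative that is continuous; for the
   unit circle C^1 suffices. Derivatives are taken within the parameter interval, hence
   one-sided at its endpoints. *)
definition smooth_curve_on :: "real set \<Rightarrow> (real \<Rightarrow> real^2) \<Rightarrow> bool" where
  "smooth_curve_on I \<gamma> \<longleftrightarrow>
     (\<exists>\<gamma>\<^sub>1 \<gamma>\<^sub>2. (\<forall>s\<in>I. (\<gamma> has_vector_derivative \<gamma>\<^sub>1 s) (at s within I)) \<and>
              (\<forall>s\<in>I. (\<gamma>\<^sub>1 has_vector_derivative \<gamma>\<^sub>2 s) (at s within I)) \<and>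
              continuous_on I \<gamma>\<^sub>2)"

definition tangent_lift ::
  "real set \<Rightarrow> (real \<Rightarrow> real^2) \<Rightarrow> (real \<Rightarrow> real^2) \<Rightarrow> (real \<Rightarrow> real) \<Rightarrow> bool" where
  "tangent_lift I \<gamma> \<phi> u \<longleftrightarrow>
     continuous_on I u \<and> (\<forall>s\<in>I. vector_derivative \<gamma> (at s within I) = \<phi> (u s))"

(* The following three values do not depend on the parametrization of the unit circle
   nor on the lift. *)
definition minkowski_curvature ::
  "(real^2 \<Rightarrow> real) \<Rightarrow> real set \<Rightarrow> (real \<Rightarrow> real^2) \<Rightarrow> real \<Rightarrow> real" where
  "minkowski_curvature F I \<gamma> s =
     (THE k. \<exists>\<phi> u. minkowski_parametrization F \<phi> \<and> tangent_lift I \<gamma> \<phi> u \<and>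
                   (u has_real_derivative k) (at s within I))"

definition right_normal ::
  "(real^2 \<Rightarrow> real) \<Rightarrow> real set \<Rightarrow> (real \<Rightarrow> real^2) \<Rightarrow> real \<Rightarrow> real^2" where
  "right_normal F I \<gamma> s =
     (THE n. \<exists>\<phi> u. minkowski_parametrization F \<phi> \<and> tangent_lift I \<gamma> \<phi> u \<and>
                   (\<phi> has_vector_derivative n) (at (u s)))"

definition arc_length_curvature ::
  "(real^2 \<Rightarrow> real) \<Rightarrow> real set \<Rightarrow> (real \<Rightarrow> real^2) \<Rightarrow> real \<Rightarrow> real" where
  "arc_length_curvature F I \<gamma> s =
     (THE k. \<exists>\<phi> u. arc_length_parametrization F \<phi> \<and> tangent_lift I \<gamma> \<phi> u \<and>
                   (u has_real_derivative k) (at s within I))"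

end

theory Submission
  imports Defs
begin

text \<open>
  For any counter-clockwise parametrization \<open>\<phi>\<close> of the unit circle and any lift
  \<open>\<gamma>' = \<phi> \<circ> u\<close>, pairing \<open>\<gamma>'' = u' \<phi>'(u)\<close> with \<open>\<gamma>' = \<phi>(u)\<close> gives
  \<open>u' = [\<gamma>', \<gamma>''] / [\<gamma>', \<phi>'(u)]\<close>, so everything depends only on the tangent vector
  \<open>\<phi>'(u)\<close>. Its direction is unique because a gauge is Lipschitz. The Minkowski tangent \<open>n\<close> has
  \<open>[\<gamma>', n] = 1\<close> and the arc-length tangent is \<open>n / F n\<close>, whence \<open>k_l = F n \<cdot> k_m\<close>. Lifts exist
  because \<open>\<phi>\<close> and \<open>\<gamma>'\<close>, read as nonvanishing complex functions, have continuous logarithms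
  and the argument of \<open>\<phi>\<close> increases from \<open>-\<infinity>\<close> to \<open>\<infinity>\<close>.
\<close>

section \<open>The bracket on the plane\<close>

lemma bracket_add_right: "bracket x (y + z) = bracket x y + bracket x z"
  by (simp add: bracket_def algebra_simps)

lemma bracket_scaleR_right: "bracket x (c *\<^sub>R y) = c * bracket x y"
  by (simp add: bracket_def algebra_simps)

lemma bounded_linear_bracket: "bounded_linear (bracket x)"
  unfolding linear_conv_bounded_linear[symmetric]
  by (rule linearI) (simp_all add: bracket_add_right bracket_scaleR_right)

lemma continuous_on_bracket [continuous_intros]:
  "continuous_on S f \<Longrightarrow> continuous_on S g \<Longrightarrow> continuous_on S (\<lambda>t. bracket (f t) (g t))"
  unfolding bracket_def by (intro continuous_intros)

lemma bracket_eq_0_imp_parallel: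
  assumes "bracket p v = 0" "p \<noteq> 0"
  obtains c where "v = c *\<^sub>R p"
proof
  have "(p $ 1)\<^sup>2 + (p $ 2)\<^sup>2 \<noteq> 0"
    using assms(2) by (auto simp: vec_eq_iff forall_2)
  \<comment> \<open>The coefficient is the one of the Euclidean projection of \<open>v\<close> onto
    the line through \<open>p\<close>.\<close>
  then show "v = ((p $ 1 * v $ 1 + p $ 2 * v $ 2) / ((p $ 1)\<^sup>2 + (p $ 2)\<^sup>2)) *\<^sub>R p"
    using assms(1) by (simp add: vec_eq_iff forall_2 bracket_def field_simps power2_eq_square)
qed

section \<open>Gauges and the tangents of curves on their unit circle\<close>

text \<open>Subadditivity bounds \<open>F x - F y\<close> by \<open>F (x - y)\<close>, so a bound of
  \<open>F\<close> by a multiple of the Euclidean norm suffices; expanding in the coordinate axes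
  gives one.\<close>

lemma gauge_lipschitz:
  assumes "gauge_fun F"
  obtains C where "C > 0" "\<And>x y. \<bar>F x - F y\<bar> \<le> C * norm (x - y)"
proof -
  have pos: "F x \<ge> 0" and hom: "c > 0 \<Longrightarrow> F (c *\<^sub>R x) = c * F x" and sub: "F (x + y) \<le> F x + F y"
    and zero: "F 0 = 0" for x y c
    using assms by (auto simp: gauge_fun_def)
  \<comment> \<open>Both directions of each axis enter because \<open>F\<close> need not be
    symmetric; the summand 1 makes \<open>C\<close> visibly positive.\<close>
  define C where "C = 1 + (\<Sum>i\<in>UNIV. F (axis i 1) + F (- axis i 1))"
  have axis_le: "F (a *\<^sub>R axis i 1) \<le> \<bar>a\<bar> * (F (axis i 1) + F (- axis i 1))" for a and i :: 2
  proof (cases a "0 :: real" rule: linorder_cases)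
    case less
    then have "F (a *\<^sub>R axis i 1) = \<bar>a\<bar> * F (- axis i 1)"
      using hom[of "- a" "- axis i 1"] by simp
    then show ?thesis using pos by (simp add: distrib_left)
  next
    case greater
    then show ?thesis using pos by (simp add: hom distrib_left)
  qed (simp add: zero)
  have bound: "F x \<le> C * norm x" for x
  proof -
    have "x = (x $ 1) *\<^sub>R axis 1 1 + (x $ 2) *\<^sub>R axis 2 1"
      by (simp add: vec_eq_iff forall_2 axis_def)
    then have "F x \<le> F ((x $ 1) *\<^sub>R axis 1 1) + F ((x $ 2) *\<^sub>R axis 2 1)"
      using sub by metis
    also have "\<dots> \<le> norm x * (F (axis 1 1) + F (- axis 1 1)) + norm x * (F (axis 2 1) + F (- axis 2 1))"
      by (intro add_mono order_trans[OF axis_le] mult_right_mono component_le_norm_cart)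
        (simp_all add: pos)
    also have "\<dots> \<le> C * norm x"
      by (simp add: C_def UNIV_2 algebra_simps)
    finally show ?thesis .
  qed
  have "\<bar>F x - F y\<bar> \<le> C * norm (x - y)" for x y
    using sub[of "x - y" y] sub[of "y - x" x] bound[of "x - y"] bound[of "y - x"]
    by (simp add: norm_minus_commute)
  moreover have "C > 0"
    by (auto simp: C_def intro!: add_pos_nonneg sum_nonneg add_nonneg_nonneg pos)
  ultimately show thesis by (rule that[rotated])
qed

lemma gauge_continuous_on:
  assumes "gauge_fun F"
  shows "continuous_on S F"
proof -
  obtain C where C: "C > 0" "\<And>x y. \<bar>F x - F y\<bar> \<le> C * norm (x - y)"
    using gauge_lipschitz[OF assms] by blast
  have "C-lipschitz_on S F"
    by (rule lipschitz_onI) (use C in \<open>auto simp: dist_norm\<close>)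
  then show ?thesis by (rule lipschitz_on_continuous_on)
qed

text \<open>\<open>F\<close> itself need not be differentiable: the tangent line stays within o(h)
  of the curve, on which \<open>F\<close> is 1, and the Lipschitz bound transfers this o(h) to the
  values of \<open>F\<close>.\<close>

lemma gauge_has_derivative_along_tangent:
  assumes F: "gauge_fun F" and \<phi>: "\<And>t. F (\<phi> t) = 1" and v: "(\<phi> has_vector_derivative v) (at t)"
  shows "((\<lambda>h. F (\<phi> t + h *\<^sub>R v)) has_real_derivative 0) (at 0)"
proof -
  obtain C where C: "C > 0" "\<And>x y. \<bar>F x - F y\<bar> \<le> C * norm (x - y)"
    using gauge_lipschitz[OF F] by blast
  have "\<exists>d>0. \<forall>h. \<bar>h\<bar> < d \<longrightarrow> \<bar>F (\<phi> t + h *\<^sub>R v) - F (\<phi> t)\<bar> \<le> e * \<bar>h\<bar>" if "e > 0" for e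
  proof -
    have "e / C > 0" using that C by simp
    then obtain d where "d > 0" and d: "\<And>y. norm (y - t) < d \<Longrightarrow>
        norm (\<phi> y - \<phi> t - (y - t) *\<^sub>R v) \<le> e / C * norm (y - t)"
      using v unfolding has_vector_derivative_def has_derivative_at_alt by blast
    have "\<bar>F (\<phi> t + h *\<^sub>R v) - F (\<phi> t)\<bar> \<le> e * \<bar>h\<bar>" if "\<bar>h\<bar> < d" for h
    proof -
      have "\<bar>F (\<phi> t + h *\<^sub>R v) - F (\<phi> t)\<bar> = \<bar>F (\<phi> (t + h)) - F (\<phi> t + h *\<^sub>R v)\<bar>"
        by (simp add: \<phi>)
      also have "\<dots> \<le> C * norm (\<phi> (t + h) - (\<phi> t + h *\<^sub>R v))" by (rule C)
      also have "\<dots> \<le> C * (e / C * \<bar>h\<bar>)"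
        using d[of "t + h"] that C(1) by (intro mult_left_mono) (auto simp: algebra_simps)
      finally show ?thesis using C(1) by simp
    qed
    then show ?thesis using \<open>d > 0\<close> by blast
  qed
  then show ?thesis
    unfolding has_field_derivative_def has_derivative_at_alt by (simp add: bounded_linear_mult_right)
qed

text \<open>Differentiating \<open>F (p + h w) = (1 + h c) F (p + h / (1 + h c) v)\<close>, where \<open>w = v + c p\<close>, at \<open>h = 0\<close> gives \<open>c = 0\<close>.\<close>

lemma gauge_radial_part_zero:
  assumes F: "gauge_fun F" and p: "F p = 1"
    and v: "((\<lambda>h. F (p + h *\<^sub>R v)) has_real_derivative 0) (at 0)"
    and w: "((\<lambda>h. F (p + h *\<^sub>R (v + c *\<^sub>R p))) has_real_derivative 0) (at 0)"
  shows "c = 0"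
proof -
  have "((\<lambda>h. (1 + h * c) * F (p + (h / (1 + h * c)) *\<^sub>R v)) has_real_derivative c) (at 0)"
  proof -
    have "((\<lambda>h. h / (1 + h * c)) has_real_derivative 1) (at 0)"
      by (auto intro!: derivative_eq_intros)
    then have "((\<lambda>h. F (p + (h / (1 + h * c)) *\<^sub>R v)) has_real_derivative 0) (at 0)"
      using DERIV_chain2[where f = "\<lambda>h. F (p + h *\<^sub>R v)" and g = "\<lambda>h. h / (1 + h * c)" and x = 0] v
      by fastforce
    then show ?thesis
      by (auto intro!: derivative_eq_intros simp: p)
  qed
  moreover have "\<forall>\<^sub>F h in nhds 0. (1 + h * c) * F (p + (h / (1 + h * c)) *\<^sub>R v) = F (p + h *\<^sub>R (v + c *\<^sub>R p))"
  proof -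
    \<comment> \<open>Homogeneity is available for positive factors only, hence the restriction to
      \<open>h\<close> near 0.\<close>
    have "((\<lambda>h. 1 + h * c) \<longlongrightarrow> 1 + 0 * c) (nhds 0)"
      by (intro tendsto_intros filterlim_ident)
    then have "\<forall>\<^sub>F h in nhds 0. 1 + h * c > 0"
      using order_tendstoD(1)[of "\<lambda>h. 1 + h * c" "1 + 0 * c" "nhds 0" 0] by simp
    then show ?thesis
    proof eventually_elim
      case (elim h)
      then have "(1 + h * c) * F (p + (h / (1 + h * c)) *\<^sub>R v)
          = F ((1 + h * c) *\<^sub>R (p + (h / (1 + h * c)) *\<^sub>R v))"
        using F by (simp add: gauge_fun_def)
      also have "(1 + h * c) *\<^sub>R (p + (h / (1 + h * c)) *\<^sub>R v) = p + h *\<^sub>R (v + c *\<^sub>R p)"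
        using elim by (simp add: scaleR_add_right scaleR_add_left mult.commute)
      finally show ?case .
    qed
  qed
  ultimately have "((\<lambda>h. F (p + h *\<^sub>R (v + c *\<^sub>R p))) has_real_derivative c) (at 0)"
    by (subst DERIV_cong_ev[symmetric, OF refl _ refl])
  then show ?thesis using w DERIV_unique by blast
qed

text \<open>Equal brackets with the common point leave only a radial difference between the
  velocities. \<open>F\<close> has derivative 0 along both tangent lines, so the radial part
  vanishes.\<close>

lemma gauge_curve_tangent_unique:
  assumes F: "gauge_fun F" and "\<And>t. F (\<phi> t) = 1" "\<And>t. F (\<psi> t) = 1"
    and v: "(\<phi> has_vector_derivative v) (at a)" and w: "(\<psi> has_vector_derivative w) (at b)"
    and eq: "\<phi> a = \<psi> b" "bracket (\<phi> a) v = bracket (\<phi> a) w"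
  shows "v = w"
proof -
  have "\<phi> a \<noteq> 0"
    using F assms(2)[of a] unfolding gauge_fun_def by (metis zero_neq_one)
  moreover have "bracket (\<phi> a) (w - v) = 0"
    using eq by (simp add: bracket_def algebra_simps)
  ultimately obtain c where "w - v = c *\<^sub>R \<phi> a"
    using bracket_eq_0_imp_parallel by metis
  then have "w = v + c *\<^sub>R \<phi> a" by (simp add: algebra_simps)
  moreover have "c = 0"
    using gauge_radial_part_zero[OF F assms(2) gauge_has_derivative_along_tangent[OF F assms(2) v], of c]
      gauge_has_derivative_along_tangent[OF F assms(3) w] eq calculation by simp
  ultimately show ?thesis by simp
qed

lemma has_vector_derivative_comp_real:
  assumes "(u has_real_derivative k) (at s within I)" "(\<phi> has_vector_derivative v) (at (u s))"
  shows "((\<lambda>s. \<phi> (u s)) has_vector_derivative k *\<^sub>R v) (at s within I)"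
  using vector_diff_chain_within[of u k s I \<phi> v] assms
  by (simp add: o_def has_real_derivative_iff_has_vector_derivative has_vector_derivative_at_within)

text \<open>Running each curve affinely at a speed equal to the bracket of the other makes the two
  brackets with the common point equal, which reduces the claim to uniqueness of the
  tangent.\<close>

lemma gauge_curve_tangents_parallel:
  assumes F: "gauge_fun F" and \<phi>: "\<And>t. F (\<phi> t) = 1" and \<psi>: "\<And>t. F (\<psi> t) = 1"
    and v: "(\<phi> has_vector_derivative v) (at a)" and w: "(\<psi> has_vector_derivative w) (at b)"
    and eq: "\<phi> a = \<psi> b"
  shows "bracket (\<phi> a) w *\<^sub>R v = bracket (\<phi> a) v *\<^sub>R w"
proof -
  have affine: "((\<lambda>t. a + t * k) has_real_derivative k) (at 0)" for a k :: real
    using DERIV_add[OF DERIV_const DERIV_cmult_Id[of k]] by (fastforce simp: mult.commute)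
  have "((\<lambda>t. \<phi> (a + t * bracket (\<phi> a) w)) has_vector_derivative bracket (\<phi> a) w *\<^sub>R v) (at 0)"
    "((\<lambda>t. \<psi> (b + t * bracket (\<phi> a) v)) has_vector_derivative bracket (\<phi> a) v *\<^sub>R w) (at 0)"
    by (rule has_vector_derivative_comp_real[OF affine]; simp add: v w)+
  then show ?thesis
    by (rule gauge_curve_tangent_unique[OF F \<phi> \<psi>]) (simp_all add: eq bracket_scaleR_right)
qed

text \<open>A velocity with zero bracket would have to agree with that of the constant curve at the
  same point.\<close>

lemma gauge_curve_bracket_nonzero:
  assumes F: "gauge_fun F" and \<phi>: "\<And>t. F (\<phi> t) = 1"
    and v: "(\<phi> has_vector_derivative v) (at a)" and "v \<noteq> 0"
  shows "bracket (\<phi> a) v \<noteq> 0"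
proof
  assume "bracket (\<phi> a) v = 0"
  then have "v = 0"
    by (intro gauge_curve_tangent_unique[OF F \<phi> _ v, where \<psi> = "\<lambda>_. \<phi> a"]) (auto simp: bracket_def \<phi>)
  then show False using \<open>v \<noteq> 0\<close> by contradiction
qed

section \<open>Inverting primitives of positive periodic functions, and injectivity over a
  period\<close>

text \<open>\<open>G\<close> gains the same positive amount over each period of \<open>f\<close>, so
  it is unbounded in both directions and hence onto. This serves twice: for changes of parameter and
  for inverting the polar angle.\<close>

lemma periodic_derivative_inverse:
  fixes G f :: "real \<Rightarrow> real"
  assumes T: "T > 0" and G: "\<And>t. (G has_real_derivative f t) (at t)"
    and pos: "\<And>t. f t > 0" and per: "\<And>t. f (t + T) = f t"
  obtains H where "\<And>t. H (G t) = t" "\<And>x. G (H x) = x"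
    "\<And>x. (H has_real_derivative inverse (f (H x))) (at x)"
    "strict_mono H" "G T - G 0 > 0" "\<And>x. H (x + (G T - G 0)) = H x + T"
proof -
  define U where "U = G T - G 0"
  have mono: "strict_mono G"
    using DERIV_pos_imp_increasing G pos by (metis strict_monoI)
  have shift: "G (t + T) = G t + U" for t
  proof -
    have "((\<lambda>t. G (t + T) - G t) has_real_derivative 0) (at t)" for t
    proof -
      have "((\<lambda>t. G (t + T)) has_real_derivative f t) (at t)"
        using G[of "t + T"] unfolding DERIV_shift per .
      then show ?thesis
        using DERIV_diff[OF _ G[of t]] by fastforce
    qed
    then show ?thesis
      using DERIV_isconst_all[of "\<lambda>t. G (t + T) - G t" t 0] by (simp add: U_def)
  qed
  have "U > 0"
    using mono T by (simp add: U_def strict_mono_less)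
  have multiple: "G (real n * T) = G 0 + real n * U" "G (- (real n * T)) = G 0 - real n * U" for n
  proof (induction n)
    case (Suc n)
    {
      case 1
      show ?case using shift[of "real n * T"] Suc by (simp add: algebra_simps)
    next
      case 2
      show ?case using shift[of "- (real (Suc n) * T)"] Suc by (simp add: algebra_simps)
    }
  qed simp_all
  have "\<exists>t. G t = x" for x
  proof -
    obtain n where n: "\<bar>x - G 0\<bar> / U < real n"
      using reals_Archimedean2 by blast
    then have "\<bar>x - G 0\<bar> < real n * U"
      using \<open>U > 0\<close> by (simp add: field_simps)
    then have "G (- (real n * T)) \<le> x" "x \<le> G (real n * T)"
      by (auto simp: multiple)
    moreover have "continuous_on {- (real n * T)..real n * T} G"
      using G DERIV_isCont by (blast intro: continuous_at_imp_continuous_on)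
    moreover have "- (real n * T) \<le> real n * T"
      using T by simp
    ultimately show ?thesis
      using IVT'[of G] by blast
  qed
  then obtain H where GH: "\<And>x. G (H x) = x" by metis
  have HG: "H (G t) = t" for t
    using GH strict_mono_eq[OF mono] by blast
  have "isCont H x" for x
    using isCont_inverse_function[of 1 "H x" H G] HG GH G DERIV_isCont by force
  then have H': "(H has_real_derivative inverse (f (H x))) (at x)" for x
    by (intro DERIV_inverse_function[where f = G and a = "x - 1" and b = "x + 1"])
      (use G pos[of "H x"] GH in auto)
  have "strict_mono H"
    using strict_mono_less[OF mono] GH by (metis strict_monoI)
  moreover have "H (x + U) = H x + T" for x
    by (metis GH HG shift)
  ultimately show thesis
    using that GH HG H' \<open>U > 0\<close> unfolding U_def by blast
qed

text \<open>Injectivity on the base period passes to any window of that length: reduction modulo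
  \<open>T\<close> shows that \<open>s / T\<close> and \<open>t / T\<close> have the same fractional
  part, and being less than 1 apart they coincide.\<close>

lemma periodic_inj_on:
  fixes \<psi> :: "real \<Rightarrow> 'a"
  assumes "T > 0" "\<And>t. \<psi> (t + T) = \<psi> t" "inj_on \<psi> {0..<T}" "\<psi> s = \<psi> t" "\<bar>s - t\<bar> < T"
  shows "s = t"
proof -
  have nat: "\<psi> (t + real n * T) = \<psi> t" for n t
  proof (induction n)
    case (Suc n)
    then show ?case using assms(2)[of "t + real n * T"] by (simp add: algebra_simps)
  qed simp
  have int: "\<psi> (t + of_int k * T) = \<psi> t" for k t
    using nat[of t "nat k"] nat[of "t + of_int k * T" "nat (- k)"] by (cases "k \<ge> 0") auto
  have red: "\<psi> (T * frac (r / T)) = \<psi> r" "T * frac (r / T) \<in> {0..<T}" for r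
  proof -
    have "T * frac (r / T) = r + of_int (- \<lfloor>r / T\<rfloor>) * T"
      using assms(1) by (simp add: frac_def field_simps)
    then show "\<psi> (T * frac (r / T)) = \<psi> r" by (simp only: int)
    show "T * frac (r / T) \<in> {0..<T}"
      using assms(1) frac_lt_1[of "r / T"] by (simp add: mult_less_cancel_left1)
  qed
  have "T * frac (s / T) = T * frac (t / T)"
    using red[of s] red[of t] inj_onD[OF assms(3)] assms(4) by metis
  then have *: "frac (s / T) = frac (t / T)" using assms(1) by simp
  have "\<bar>s / T - t / T\<bar> < 1"
    using assms(1,5) by (simp add: diff_divide_distrib[symmetric])
  with * have "\<lfloor>s / T\<rfloor> = \<lfloor>t / T\<rfloor>"
    by (simp add: frac_def)
  with * show ?thesis using assms(1) by (simp add: frac_def)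
qed

section \<open>Counter-clockwise parametrizations of the unit circle and changes of
  parameter\<close>

lemma closed_parametrization_derivative:
  assumes "closed_parametrization S \<psi>"
  shows "(\<psi> has_vector_derivative vector_derivative \<psi> (at t)) (at t)"
    and "continuous_on A (\<lambda>t. vector_derivative \<psi> (at t))"
  using assms unfolding closed_parametrization_def C1_differentiable_on_eq
  by (auto simp: vector_derivative_works[symmetric] intro: continuous_on_subset)

lemma closed_parametrization_continuous:
  assumes "closed_parametrization S \<psi>"
  shows "continuous_on A \<psi>"
  using closed_parametrization_derivative(1)[OF assms] has_vector_derivative_continuous
  by (blast intro: continuous_at_imp_continuous_on)

text \<open>Translation carries every derivative at one point to the other, so the choice operator
  in \<open>vector_derivative\<close> picks the same value whether or not a derivative
  exists.\<close>

lemma periodic_vector_derivative: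
  fixes \<psi> :: "real \<Rightarrow> 'a::real_normed_vector"
  assumes "\<And>t. \<psi> (t + T) = \<psi> t"
  shows "vector_derivative \<psi> (at (t + T)) = vector_derivative \<psi> (at t)"
proof -
  have per: "\<psi> (t - T) = \<psi> t" for t
    using assms[of "t - T"] by simp
  have translation: "((\<lambda>t. t + a) has_real_derivative 1) (at t)" for a t :: real
    using DERIV_add[OF DERIV_ident DERIV_const] by fastforce
  have "(\<psi> has_vector_derivative d) (at (t + T)) \<longleftrightarrow> (\<psi> has_vector_derivative d) (at t)" for d
  proof
    show "(\<psi> has_vector_derivative d) (at t)" if "(\<psi> has_vector_derivative d) (at (t + T))"
      using has_vector_derivative_comp_real[of "\<lambda>t. t + T" 1 t UNIV \<psi> d] translation that
      by (simp add: assms)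
    show "(\<psi> has_vector_derivative d) (at (t + T))" if "(\<psi> has_vector_derivative d) (at t)"
      using has_vector_derivative_comp_real[of "\<lambda>t. t + - T" 1 "t + T" UNIV \<psi> d] translation[of "- T"] that
      by (simp add: per)
  qed
  then show ?thesis by (simp add: vector_derivative_def)
qed

lemma ccw_parametrization_facts:
  assumes "ccw_parametrization F \<psi>"
  shows "F (\<psi> t) = 1"
    and "(\<psi> has_vector_derivative vector_derivative \<psi> (at t)) (at t)"
    and "continuous_on A \<psi>" "continuous_on A (\<lambda>t. vector_derivative \<psi> (at t))"
    and "bracket (\<psi> t) (vector_derivative \<psi> (at t)) > 0"
    and "vector_derivative \<psi> (at t) \<noteq> 0" "\<exists>T>0. \<forall>t. \<psi> (t + T) = \<psi> t"
  using assms closed_parametrization_derivative closed_parametrization_continuous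
  unfolding ccw_parametrization_def by (auto simp: closed_parametrization_def unit_circle_def)

text \<open>The map is \<open>\<psi>\<close> composed with the inverse \<open>H\<close> of
  \<open>G\<close>, so velocities are divided by \<open>f\<close>. Common source of the Minkowski
  and the arc-length parametrization; \<open>per\<close> ranges over all periods because a
  particular one becomes available only inside the proof.\<close>

lemma ccw_parametrization_reparametrize:
  assumes \<psi>: "ccw_parametrization F \<psi>"
    and G: "\<And>t. (G has_real_derivative f t) (at t)" and f: "continuous_on UNIV f" "\<And>t. f t > 0"
    and per: "\<And>T t. (\<And>t. \<psi> (t + T) = \<psi> t) \<Longrightarrow> f (t + T) = f t"
    and \<phi>: "\<And>t. \<phi> (G t) = \<psi> t"
  shows "ccw_parametrization F \<phi>" "surj G"
    "(\<phi> has_vector_derivative inverse (f t) *\<^sub>R vector_derivative \<psi> (at t)) (at (G t))"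
proof -
  define \<psi>' where "\<psi>' t = vector_derivative \<psi> (at t)" for t
  have closed: "closed_parametrization (unit_circle F) \<psi>" and ccw: "bracket (\<psi> t) (\<psi>' t) > 0" for t
    using \<psi> by (auto simp: ccw_parametrization_def \<psi>'_def)
  obtain T where T: "T > 0" "\<And>t. \<psi> (t + T) = \<psi> t" "inj_on \<psi> {0..<T}"
    and range: "range \<psi> = unit_circle F" and nz: "\<And>t. \<psi>' t \<noteq> 0"
    using closed by (auto simp: closed_parametrization_def \<psi>'_def)
  obtain H where HG: "\<And>t. H (G t) = t" and GH: "\<And>x. G (H x) = x"
    and H': "\<And>x. (H has_real_derivative inverse (f (H x))) (at x)" and mono: "strict_mono H"
    and U: "G T - G 0 > 0" "\<And>x. H (x + (G T - G 0)) = H x + T"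
    using periodic_derivative_inverse[OF T(1) G f(2) per] T(2) by metis
  have \<phi>_eq: "\<phi> = (\<lambda>x. \<psi> (H x))"
    using \<phi> GH by metis
  have deriv: "(\<phi> has_vector_derivative inverse (f (H x)) *\<^sub>R \<psi>' (H x)) (at x)" for x
    unfolding \<phi>_eq \<psi>'_def
    by (intro has_vector_derivative_comp_real H' closed_parametrization_derivative[OF closed])
  then show "(\<phi> has_vector_derivative inverse (f t) *\<^sub>R vector_derivative \<psi> (at t)) (at (G t))"
    by (metis HG \<psi>'_def)
  show "surj G" using GH by (metis surjI)
  have vd: "vector_derivative \<phi> (at x) = inverse (f (H x)) *\<^sub>R \<psi>' (H x)" for x
    using deriv by (rule vector_derivative_at)
  have contH: "continuous_on UNIV H"
    using H' DERIV_isCont by (blast intro: continuous_at_imp_continuous_on)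
  have "\<phi> C1_differentiable_on UNIV"
    unfolding C1_differentiable_on_eq
  proof
    show "\<forall>x\<in>UNIV. \<phi> differentiable at x"
      using deriv differentiableI_vector by blast
    show "continuous_on UNIV (\<lambda>x. vector_derivative \<phi> (at x))"
      unfolding vd \<psi>'_def
      by (intro continuous_intros continuous_on_compose2[OF f(1) contH]
        continuous_on_compose2[OF closed_parametrization_derivative(2)[OF closed, of UNIV] contH])
        (use f(2) in \<open>auto simp: less_imp_neq[symmetric]\<close>)
  qed
  moreover have "range \<phi> = unit_circle F"
    unfolding range[symmetric] \<phi>_eq using HG by (auto simp: image_iff) metis
  moreover have "\<exists>U>0. (\<forall>x. \<phi> (x + U) = \<phi> x) \<and> inj_on \<phi> {0..<U}"
  proof (intro exI[of _ "G T - G 0"] conjI allI)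
    show "inj_on \<phi> {0..<G T - G 0}"
    proof (rule inj_onI)
      fix x y assume xy: "x \<in> {0..<G T - G 0}" "y \<in> {0..<G T - G 0}" "\<phi> x = \<phi> y"
      \<comment> \<open>One period of \<open>\<phi>\<close> is mapped to a half-open window of
        length \<open>T\<close> that need not start at 0.\<close>
      have "H 0 \<le> H z \<and> H z < H 0 + T" if "z \<in> {0..<G T - G 0}" for z
        using that U(2)[of 0] by (auto simp: strict_mono_less[OF mono] strict_mono_less_eq[OF mono]
          simp flip: U(2)[of 0])
      from this[OF xy(1)] this[OF xy(2)] have "H x = H y"
        by (intro periodic_inj_on[OF T]) (use xy(3) in \<open>auto simp: \<phi>_eq\<close>)
      then show "x = y" using strict_mono_eq[OF mono] by blast
    qed
  qed (use U T(2) in \<open>auto simp: \<phi>_eq\<close>)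
  moreover have "vector_derivative \<phi> (at x) \<noteq> 0" "bracket (\<phi> x) (vector_derivative \<phi> (at x)) > 0" for x
    using ccw[of "H x"] nz[of "H x"] f(2)[of "H x"] unfolding vd bracket_scaleR_right
    by (auto simp: \<phi>_eq)
  ultimately show "ccw_parametrization F \<phi>"
    unfolding ccw_parametrization_def closed_parametrization_def by blast
qed

lemma interval_integral_has_vector_derivative:
  fixes f :: "real \<Rightarrow> 'a::euclidean_space"
  assumes "continuous_on UNIV f"
  shows "((\<lambda>t. LBINT \<tau>=ereal a..ereal t. f \<tau>) has_vector_derivative f t) (at t)"
proof -
  \<comment> \<open>The margins put \<open>t\<close> in the interior, so that the derivative within
    the interval is a two-sided one.\<close>
  let ?l = "min a t - 1" and ?r = "max a t + 1"
  have "((\<lambda>t. LBINT \<tau>=ereal a..ereal t. f \<tau>) has_vector_derivative f t) (at t within {?l..?r})"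
    by (intro interval_integral_FTC2 continuous_on_subset[OF assms]) auto
  then show ?thesis
    by (subst (asm) at_within_interior) auto
qed

lemma continuous_nonzero_same_sign:
  fixes f :: "real \<Rightarrow> real"
  assumes "continuous_on UNIV f" "\<And>t. f t \<noteq> 0"
  shows "(\<forall>t. f t > 0) \<or> (\<forall>t. f t < 0)"
proof (rule ccontr)
  assume "\<not> ?thesis"
  then obtain a b where "f a < 0" "f b > 0"
    using assms(2) by (meson linorder_neqE_linordered_idom)
  moreover have "connected (range f)"
    using assms(1) connected_UNIV by (rule connected_continuous_image)
  ultimately have "0 \<in> range f"
    by (meson connectedD_interval rangeI less_imp_le)
  then show False using assms(2) by force
qed

text \<open>The bracket of position and velocity is continuous and never zero, hence of constant
  sign; if it is negative, reversing time corrects it.\<close>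

lemma ccw_parametrization_exists:
  assumes F: "gauge_fun F" and S: "smooth_closed_curve (unit_circle F)"
  obtains \<psi> where "ccw_parametrization F \<psi>"
proof -
  obtain \<psi> where \<psi>: "closed_parametrization (unit_circle F) \<psi>"
    using S by (auto simp: smooth_closed_curve_def)
  then have one: "F (\<psi> t) = 1" for t
    unfolding closed_parametrization_def unit_circle_def by blast
  define \<psi>' where "\<psi>' t = vector_derivative \<psi> (at t)" for t
  have \<psi>': "(\<psi> has_vector_derivative \<psi>' t) (at t)" for t
    unfolding \<psi>'_def using closed_parametrization_derivative[OF \<psi>] by blast
  have cont: "continuous_on A \<psi>'" for A
    unfolding \<psi>'_def using closed_parametrization_derivative[OF \<psi>] by blast
  obtain T where T: "T > 0" "\<And>t. \<psi> (t + T) = \<psi> t" "inj_on \<psi> {0..<T}"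
    and range: "range \<psi> = unit_circle F" and nz: "\<And>t. \<psi>' t \<noteq> 0"
    using \<psi> by (auto simp: closed_parametrization_def \<psi>'_def)
  have "(\<forall>t. bracket (\<psi> t) (\<psi>' t) > 0) \<or> (\<forall>t. bracket (\<psi> t) (\<psi>' t) < 0)"
    by (intro continuous_nonzero_same_sign continuous_intros cont
      closed_parametrization_continuous[OF \<psi>] gauge_curve_bracket_nonzero[OF F one \<psi>' nz])
  then show thesis
  proof
    assume "\<forall>t. bracket (\<psi> t) (\<psi>' t) > 0"
    then show thesis
      using \<psi> that by (auto simp: ccw_parametrization_def \<psi>'_def)
  next
    assume neg: "\<forall>t. bracket (\<psi> t) (\<psi>' t) < 0"
    define \<phi> where "\<phi> t = \<psi> (- t)" for t
    have deriv: "(\<phi> has_vector_derivative - \<psi>' (- t)) (at t)" for t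
      using has_vector_derivative_comp_real[OF DERIV_minus[OF DERIV_ident] \<psi>']
      by (simp add: \<phi>_def[abs_def])
    then have vd: "vector_derivative \<phi> (at t) = - \<psi>' (- t)" for t
      by (rule vector_derivative_at)
    have "\<phi> C1_differentiable_on UNIV"
      unfolding C1_differentiable_on_eq vd
      by (intro conjI ballI differentiableI_vector[OF deriv] continuous_on_minus
        continuous_on_compose2[OF cont[of UNIV]] continuous_on_id) simp
    moreover have "range \<phi> = range \<psi>"
      unfolding \<phi>_def by (simp flip: image_image[of \<psi> uminus])
    moreover have "inj_on \<phi> {0..<T}"
    proof (rule inj_onI)
      fix s t assume "s \<in> {0..<T}" "t \<in> {0..<T}" "\<phi> s = \<phi> t"
      then have "- s = - t"
        by (intro periodic_inj_on[OF T]) (auto simp: \<phi>_def)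
      then show "s = t" by simp
    qed
    moreover have "\<phi> (t + T) = \<phi> t" for t
      using T(2)[of "- t - T"] by (simp add: \<phi>_def)
    moreover have "bracket (\<phi> t) (vector_derivative \<phi> (at t)) > 0" for t
      using neg[rule_format, of "- t"] by (simp add: vd \<phi>_def bracket_def)
    ultimately show thesis
      using T(1) nz range that[of \<phi>]
      unfolding ccw_parametrization_def closed_parametrization_def vd by auto
  qed
qed

section \<open>Polar angle and lifting of unit vectors\<close>

definition complex_of_vec :: "real^2 \<Rightarrow> complex" where
  "complex_of_vec x = Complex (x $ 1) (x $ 2)"

lemma bounded_linear_complex_of_vec: "bounded_linear complex_of_vec"
  unfolding linear_conv_bounded_linear[symmetric]
  by (rule linearI) (simp_all add: complex_of_vec_def complex_eq_iff)

lemma complex_of_vec_eq_0_iff [simp]: "complex_of_vec x = 0 \<longleftrightarrow> x = 0"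
  by (simp add: complex_of_vec_def complex_eq_iff vec_eq_iff forall_2)

text \<open>For \<open>y\<close> the velocity at \<open>x\<close>, this is the angular speed; its
  sign is that of the bracket.\<close>

lemma Im_complex_of_vec_divide:
  "Im (complex_of_vec y / complex_of_vec x) = bracket x y / ((x $ 1)\<^sup>2 + (x $ 2)\<^sup>2)"
  by (simp add: complex_of_vec_def bracket_def Im_divide algebra_simps)

text \<open>By positive homogeneity, a ray from the origin meets the unit circle only once.\<close>

lemma gauge_unit_vectors_same_argument:
  assumes F: "gauge_fun F" "F x = 1" "F y = 1"
    and xy: "complex_of_vec x = exp z" "complex_of_vec y = exp w" "Im z = Im w"
  shows "x = y"
proof -
  have "exp z = exp (of_real (Re z - Re w)) * exp w"
  proof -
    have "z = of_real (Re z - Re w) + w"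
      using xy(3) by (simp add: complex_eq_iff)
    then show ?thesis by (simp flip: exp_add)
  qed
  then have "complex_of_vec x = complex_of_vec (exp (Re z - Re w) *\<^sub>R y)"
    using xy(1,2)
    unfolding linear_cmul[OF bounded_linear.linear[OF bounded_linear_complex_of_vec]]
    by (simp only: scaleR_conv_of_real exp_of_real)
  then have eq: "x = exp (Re z - Re w) *\<^sub>R y"
    by (simp add: complex_of_vec_def complex_eq_iff vec_eq_iff forall_2)
  moreover have "F (exp (Re z - Re w) *\<^sub>R y) = exp (Re z - Re w) * F y"
    using F(1) exp_gt_zero unfolding gauge_fun_def by blast
  ultimately show ?thesis using F(2,3) by simp
qed

text \<open>The lift is \<open>u s = H (Im (g s))\<close>, where \<open>g\<close> is a logarithm of
  \<open>c\<close> and \<open>H\<close> inverts the polar angle of \<open>\<phi>\<close>. Then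
  \<open>c s\<close> and \<open>\<phi> (u s)\<close> lie on the same ray.\<close>

lemma ccw_parametrization_lift:
  assumes F: "gauge_fun F" and \<phi>: "ccw_parametrization F \<phi>"
    and I: "is_interval I" and c: "continuous_on I c" "\<And>s. s \<in> I \<Longrightarrow> F (c s) = 1"
  obtains u where "continuous_on I u" "\<And>s. s \<in> I \<Longrightarrow> c s = \<phi> (u s)"
proof -
  note facts = ccw_parametrization_facts[OF \<phi>]
  have nz: "x \<noteq> 0" if "F x = 1" for x
    using F that unfolding gauge_fun_def by (metis zero_neq_one)
  define z where "z t = complex_of_vec (\<phi> t)" for t
  define z' where "z' t = complex_of_vec (vector_derivative \<phi> (at t))" for t
  have z0: "z t \<noteq> 0" for t
    using nz facts(1) by (simp add: z_def)
  have z': "(z has_vector_derivative z' t) (at t)" for t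
    unfolding z_def z'_def
    by (intro bounded_linear.has_vector_derivative[OF bounded_linear_complex_of_vec] facts)
  have "continuous_on UNIV (\<lambda>t. z' t / z t)"
    using z0 unfolding z_def z'_def
    by (intro continuous_intros bounded_linear.continuous_on[OF bounded_linear_complex_of_vec] facts) auto
  \<comment> \<open>An explicit logarithm of \<open>z\<close>, because its derivative is needed; the
    constant \<open>Ln (z 0)\<close> fixes the value at 0.\<close>
  define L where "L t = Ln (z 0) + (LBINT \<tau>=ereal 0..ereal t. z' \<tau> / z \<tau>)" for t
  have L': "(L has_vector_derivative z' t / z t) (at t)" for t
    unfolding L_def
    using has_vector_derivative_add[OF has_vector_derivative_const
        interval_integral_has_vector_derivative[OF \<open>continuous_on UNIV (\<lambda>t. z' t / z t)\<close>]]
    by simp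
  have L0: "exp (L 0) = z 0"
    using z0[of 0] by (simp add: L_def)
  have L: "z t = exp (L t)" for t
  proof -
    have "((\<lambda>t. z t * exp (- L t)) has_vector_derivative 0) (at t)" for t
    proof -
      have "((\<lambda>t. exp (- L t)) has_vector_derivative - (z' t / z t) * exp (- L t)) (at t)"
        using field_vector_diff_chain_at[of "\<lambda>t. - L t" "- (z' t / z t)" t exp "exp (- L t)"] L'[of t]
        by (simp add: o_def has_vector_derivative_minus DERIV_exp)
      from has_vector_derivative_mult[OF z' this] show ?thesis
        using z0[of t] by simp
    qed
    then have "z t * exp (- L t) = z 0 * exp (- L 0)"
      by (intro has_derivative_zero_unique[of UNIV]) (auto simp: has_vector_derivative_def)
    then show ?thesis
      using z0[of 0] by (simp add: L0 exp_minus field_simps)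
  qed
  define \<omega> where "\<omega> t = Im (z' t / z t)" for t
  have \<omega>_eq: "\<omega> t = bracket (\<phi> t) (vector_derivative \<phi> (at t)) / ((\<phi> t $ 1)\<^sup>2 + (\<phi> t $ 2)\<^sup>2)" for t
    unfolding \<omega>_def z_def z'_def by (rule Im_complex_of_vec_divide)
  have \<omega>: "((\<lambda>t. Im (L t)) has_real_derivative \<omega> t) (at t)" for t
    unfolding has_real_derivative_iff_has_vector_derivative \<omega>_def
    by (rule bounded_linear.has_vector_derivative[OF bounded_linear_Im L'])
  have pos: "\<omega> t > 0" for t
    using nz[OF facts(1)[of t]] facts(5)[of t] unfolding \<omega>_eq
    by (intro divide_pos_pos) (auto simp: vec_eq_iff forall_2 sum_power2_gt_zero_iff)
  obtain T where T: "T > 0" "\<And>t. \<phi> (t + T) = \<phi> t"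
    using facts(7) by blast
  \<comment> \<open>The polar angle gains a full amount at each turn; only its derivative is
    periodic.\<close>
  have per: "\<omega> (t + T) = \<omega> t" for t
    unfolding \<omega>_eq periodic_vector_derivative[of \<phi>, OF T(2)] T(2) ..
  obtain H where H: "\<And>x. Im (L (H x)) = x" "\<And>x. (H has_real_derivative inverse (\<omega> (H x))) (at x)"
    using periodic_derivative_inverse[of T "\<lambda>t. Im (L t)" \<omega>, OF T(1) \<omega> pos per] by metis
  \<comment> \<open>The curve \<open>c\<close> is merely continuous, so its logarithm comes from
    topology instead of an integral.\<close>
  have "contractible I"
    using I by (simp add: convex_imp_contractible is_interval_convex)
  then obtain g where g: "continuous_on I g" "\<And>s. s \<in> I \<Longrightarrow> complex_of_vec (c s) = exp (g s)"
    using continuous_logarithm_on_contractible[of I "\<lambda>s. complex_of_vec (c s)"] nz c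
      bounded_linear.continuous_on[OF bounded_linear_complex_of_vec c(1)]
    by (metis complex_of_vec_eq_0_iff)
  show thesis
  proof
    have "continuous_on UNIV H"
      using H(2) DERIV_isCont by (blast intro: continuous_at_imp_continuous_on)
    then show "continuous_on I (\<lambda>s. H (Im (g s)))"
      by (rule continuous_on_compose2) (auto intro!: continuous_intros g)
    show "c s = \<phi> (H (Im (g s)))" if "s \<in> I" for s
      using gauge_unit_vectors_same_argument[OF F c(2)[OF that] facts(1) g(2)[OF that]] L H(1)
      unfolding z_def by metis
  qed
qed

section \<open>Existence and normalization of the Minkowski and arc-length parametrizations\<close>

lemma interval_integral_has_real_derivative:
  fixes f :: "real \<Rightarrow> real"
  assumes "continuous_on UNIV f"
  shows "((\<lambda>t. LBINT \<tau>=ereal a..ereal t. f \<tau>) has_real_derivative f t) (at t)"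
  using interval_integral_has_vector_derivative[OF assms]
  by (simp add: has_real_derivative_iff_has_vector_derivative)

lemma reparametrize_exists:
  fixes G f :: "real \<Rightarrow> real"
  assumes "\<And>t. (G has_real_derivative f t) (at t)" "\<And>t. f t > 0"
  obtains \<phi> where "\<And>t. \<phi> (G t) = \<psi> t"
proof
  have "inj G"
    using DERIV_pos_imp_increasing assms by (metis strict_monoI strict_mono_imp_inj_on)
  then show "(\<psi> \<circ> inv G) (G t) = \<psi> t" for t
    by simp
qed

text \<open>What a change of parameter requires of its speed, for the bracket. The speed enters
  through an equation so that a local definition or \<open>refl\<close> can supply it.\<close>

lemma ccw_bracket_derivative_facts:
  assumes \<psi>: "ccw_parametrization F \<psi>"
    and f: "\<And>t. f t = bracket (\<psi> t) (vector_derivative \<psi> (at t))"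
  shows "continuous_on UNIV f" "f t > 0" "(\<And>t. \<psi> (t + T) = \<psi> t) \<Longrightarrow> f (t + T) = f t"
  using ccw_parametrization_facts[OF \<psi>] periodic_vector_derivative[of \<psi> T]
  unfolding f[abs_def] by (auto intro!: continuous_intros)

text \<open>The change of parameter divides the velocity by the bracket, which becomes 1;
  surjectivity of the integral gives this at every parameter.\<close>

lemma minkowski_parametrization_facts:
  assumes "minkowski_parametrization F \<phi>"
  shows "ccw_parametrization F \<phi>" "bracket (\<phi> x) (vector_derivative \<phi> (at x)) = 1"
proof -
  obtain \<psi> t\<^sub>0 where \<psi>: "ccw_parametrization F \<psi>" and
    \<phi>: "\<And>t. \<phi> (LBINT \<tau>=ereal t\<^sub>0..ereal t. bracket (\<psi> \<tau>) (vector_derivative \<psi> (at \<tau>))) = \<psi> t"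
    using assms unfolding minkowski_parametrization_def by blast
  define f where "f t = bracket (\<psi> t) (vector_derivative \<psi> (at t))" for t
  define G where "G t = (LBINT \<tau>=ereal t\<^sub>0..ereal t. f \<tau>)" for t
  note f = ccw_bracket_derivative_facts[OF \<psi> f_def]
  have G: "(G has_real_derivative f t) (at t)" for t
    unfolding G_def using f(1) by (rule interval_integral_has_real_derivative)
  have \<phi>: "\<phi> (G t) = \<psi> t" for t
    using \<phi> by (simp add: G_def f_def)
  note reparam = ccw_parametrization_reparametrize[OF \<psi> G f \<phi>]
  show "ccw_parametrization F \<phi>" by (rule reparam(1))
  obtain t where "x = G t" using reparam(2) by blast
  then show "bracket (\<phi> x) (vector_derivative \<phi> (at x)) = 1"
    using vector_derivative_at[OF reparam(3)[of t]] f(2)[of t]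
    by (simp add: \<phi> bracket_scaleR_right f_def)
qed

lemma minkowski_parametrization_exists:
  assumes "gauge_fun F" "smooth_closed_curve (unit_circle F)"
  obtains \<phi> where "minkowski_parametrization F \<phi>"
proof -
  obtain \<psi> where \<psi>: "ccw_parametrization F \<psi>"
    using ccw_parametrization_exists assms by blast
  note f = ccw_bracket_derivative_facts[OF \<psi> refl]
  obtain \<phi> where "\<And>t. \<phi> (LBINT \<tau>=ereal 0..ereal t. bracket (\<psi> \<tau>) (vector_derivative \<psi> (at \<tau>))) = \<psi> t"
    using reparametrize_exists[OF interval_integral_has_real_derivative[OF f(1)] f(2)] by blast
  with \<psi> that show thesis
    unfolding minkowski_parametrization_def by blast
qed

text \<open>Here the velocity is divided by its own gauge; the Lipschitz bound makes this speed
  continuous, and homogeneity turns the gauge of the new velocity into 1.\<close>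

lemma arc_length_parametrization_exists:
  assumes F: "gauge_fun F" and S: "smooth_closed_curve (unit_circle F)"
  obtains \<phi> where "arc_length_parametrization F \<phi>"
proof -
  obtain \<psi> where \<psi>: "ccw_parametrization F \<psi>"
    using ccw_parametrization_exists assms by blast
  note facts = ccw_parametrization_facts[OF \<psi>]
  define f where "f t = F (vector_derivative \<psi> (at t))" for t
  define G where "G t = (LBINT \<tau>=ereal 0..ereal t. f \<tau>)" for t
  have cont: "continuous_on UNIV f"
    unfolding f_def by (rule continuous_on_compose2[OF gauge_continuous_on[OF F, of UNIV]]) (auto intro: facts)
  have pos: "f t > 0" for t
    using F facts(6)[of t] unfolding gauge_fun_def f_def by (metis order_le_less)
  have per: "f (t + T) = f t" if "\<And>t. \<psi> (t + T) = \<psi> t" for T t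
    unfolding f_def using periodic_vector_derivative[of \<psi>, OF that] by simp
  have G: "(G has_real_derivative f t) (at t)" for t
    unfolding G_def using cont by (rule interval_integral_has_real_derivative)
  obtain \<phi> where \<phi>: "\<And>t. \<phi> (G t) = \<psi> t"
    using reparametrize_exists[OF G pos] by blast
  note reparam = ccw_parametrization_reparametrize[OF \<psi> G cont pos per \<phi>]
  have "F (vector_derivative \<phi> (at x)) = 1" for x
  proof -
    obtain t where "x = G t" using reparam(2) by blast
    then have "F (vector_derivative \<phi> (at x)) = F (inverse (f t) *\<^sub>R vector_derivative \<psi> (at t))"
      using vector_derivative_at[OF reparam(3)] by simp
    also have "\<dots> = inverse (f t) * f t"
      using F pos[of t] unfolding gauge_fun_def f_def by (meson positive_imp_inverse_positive)
    finally show ?thesis using pos[of t] by simp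
  qed
  with reparam(1) that show thesis
    unfolding arc_length_parametrization_def by blast
qed

section \<open>Derivatives of lifts and comparison of the curvatures\<close>

text \<open>A lift is assumed only continuous; its differentiability is part of the claim. Pairing
  with the fixed vector \<open>p\<close> makes the problem scalar, and the nonzero derivative
  \<open>D\<close> of the paired circle lets the difference quotient of \<open>u\<close> be solved
  for.\<close>

lemma tangent_lift_derivative:
  assumes \<phi>: "ccw_parametrization F \<phi>" and lift: "tangent_lift I \<gamma> \<phi> u" and s: "s \<in> I"
    and \<kappa>: "((\<lambda>s. vector_derivative \<gamma> (at s within I)) has_vector_derivative \<kappa>) (at s within I)"
  shows "(u has_real_derivative
           bracket (\<phi> (u s)) \<kappa> / bracket (\<phi> (u s)) (vector_derivative \<phi> (at (u s)))) (at s within I)"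
proof -
  define p where "p = \<phi> (u s)"
  define D where "D = bracket p (vector_derivative \<phi> (at (u s)))"
  define c where "c y = bracket p (vector_derivative \<gamma> (at y within I))" for y
  have c_eq: "c y = bracket p (\<phi> (u y))" if "y \<in> I" for y
    using lift that by (simp add: c_def tangent_lift_def)
  have "D \<noteq> 0"
    using ccw_parametrization_facts(5)[OF \<phi>, of "u s"] by (simp add: D_def p_def)
  have "((\<lambda>x. bracket p (\<phi> x)) has_real_derivative D) (at (u s))"
    unfolding has_real_derivative_iff_has_vector_derivative D_def
    by (intro bounded_linear.has_vector_derivative[OF bounded_linear_bracket]
      ccw_parametrization_facts(2)[OF \<phi>])
  \<comment> \<open>The Caratheodory form avoids dividing by \<open>u y - u s\<close>, which may
    vanish.\<close>
  then obtain q where q: "\<And>x. bracket p (\<phi> x) - bracket p (\<phi> (u s)) = q x * (x - u s)"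
      "isCont q (u s)" "q (u s) = D"
    unfolding CARAT_DERIV by blast
  have "(u \<longlongrightarrow> u s) (at s within I)"
    using lift s by (auto simp: tangent_lift_def continuous_on_def)
  then have qu: "((\<lambda>y. q (u y)) \<longlongrightarrow> D) (at s within I)"
    using q(2,3) isCont_tendsto_compose by blast
  have "(c has_real_derivative bracket p \<kappa>) (at s within I)"
    unfolding c_def[abs_def] has_real_derivative_iff_has_vector_derivative
    by (rule bounded_linear.has_vector_derivative[OF bounded_linear_bracket \<kappa>])
  then have "((\<lambda>y. (c y - c s) / (y - s) / q (u y)) \<longlongrightarrow> bracket p \<kappa> / D) (at s within I)"
    unfolding has_field_derivative_iff using qu \<open>D \<noteq> 0\<close> by (rule tendsto_divide)
  moreover have "\<forall>\<^sub>F y in at s within I. (c y - c s) / (y - s) / q (u y) = (u y - u s) / (y - s)"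
  proof -
    have "\<forall>\<^sub>F y in at s within I. q (u y) \<noteq> 0"
      using qu \<open>D \<noteq> 0\<close> by (rule tendsto_imp_eventually_ne)
    moreover have "\<forall>\<^sub>F y in at s within I. y \<in> I"
      by (simp add: eventually_at_filter)
    ultimately show ?thesis
    proof eventually_elim
      case (elim y)
      then show ?case using q(1)[of "u y"] s by (simp add: c_eq)
    qed
  qed
  ultimately show ?thesis
    unfolding has_field_derivative_iff p_def[symmetric] D_def[symmetric]
    by (rule Lim_transform_eventually)
qed

lemma has_real_derivative_unique_within:
  fixes f :: "real \<Rightarrow> real"
  assumes "at x within S \<noteq> bot" "(f has_real_derivative a) (at x within S)"
    "(f has_real_derivative b) (at x within S)"
  shows "a = b"
  using assms vector_derivative_unique_within
  by (auto simp: has_real_derivative_iff_has_vector_derivative)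

theorem proposition3p1:
  fixes F :: "real^2 \<Rightarrow> real" and I :: "real set" and \<gamma> :: "real \<Rightarrow> real^2"
  assumes "gauge_fun F"
    and "smooth_closed_curve (unit_circle F)"
    and "segment_free (unit_circle F)"
    and "is_interval I" and "interior I \<noteq> {}"
    and "smooth_curve_on I \<gamma>"
    and "\<forall>s\<in>I. F (vector_derivative \<gamma> (at s within I)) = 1"
  shows "\<forall>s\<in>I. arc_length_curvature F I \<gamma> s =
           F (right_normal F I \<gamma> s) * minkowski_curvature F I \<gamma> s"
proof
  fix s assume s: "s \<in> I"
  note F = assms(1)
  \<comment> \<open>An interval with interior points has no isolated points, so derivatives within
    \<open>I\<close> are unique even at its endpoints.\<close>
  have ntriv: "at t within I \<noteq> bot" if "t \<in> I" for t
  proof -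
    have "I \<noteq> {x}" for x using assms(5) by auto
    then show ?thesis
      using connected_imp_perfect[of I t] that assms(4)
      by (simp add: is_interval_connected trivial_limit_within)
  qed
  define \<tau> where "\<tau> t = vector_derivative \<gamma> (at t within I)" for t
  obtain \<gamma>1 \<gamma>2 where \<gamma>: "\<And>t. t \<in> I \<Longrightarrow> (\<gamma> has_vector_derivative \<gamma>1 t) (at t within I)"
      "\<And>t. t \<in> I \<Longrightarrow> (\<gamma>1 has_vector_derivative \<gamma>2 t) (at t within I)"
    using assms(6) unfolding smooth_curve_on_def by blast
  have \<tau>_eq: "\<tau> t = \<gamma>1 t" if "t \<in> I" for t
    unfolding \<tau>_def using that \<gamma>(1) ntriv by (intro vector_derivative_within)
  have \<tau>': "(\<tau> has_vector_derivative \<gamma>2 t) (at t within I)" if "t \<in> I" for t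
    using \<gamma>(2)[OF that] that by (rule has_vector_derivative_transform[rotated 2]) (simp add: \<tau>_eq)
  have cont: "continuous_on I \<tau>"
    unfolding continuous_on_eq_continuous_within by (intro ballI has_vector_derivative_continuous[OF \<tau>'])
  have lift_exists: "\<exists>u. tangent_lift I \<gamma> \<phi> u" if "ccw_parametrization F \<phi>" for \<phi>
    using ccw_parametrization_lift[OF F that assms(4) cont] assms(7)
    unfolding tangent_lift_def \<tau>_def by metis
  have lift_at: "\<phi> (u s) = \<tau> s" if "tangent_lift I \<gamma> \<phi> u" for \<phi> u
    using that s by (simp add: tangent_lift_def \<tau>_def)
  note lift' = tangent_lift_derivative[OF _ _ s \<tau>'[OF s, unfolded \<tau>_def[abs_def]]]

  \<comment> \<open>A reference parametrization and lift. The formulas below involve only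
    \<open>\<tau>\<close>, \<open>\<gamma>2\<close> and the tangent \<open>n\<close>, which yields
    independence of all choices in the definite descriptions.\<close>
  obtain \<phi> u where mink: "minkowski_parametrization F \<phi>" "tangent_lift I \<gamma> \<phi> u"
    using minkowski_parametrization_exists[OF assms(1,2)] minkowski_parametrization_facts(1) lift_exists
    by metis
  define n where "n = vector_derivative \<phi> (at (u s))"
  note mink_ccw = minkowski_parametrization_facts(1)[OF mink(1)]
  have n: "(\<phi> has_vector_derivative n) (at (u s))" "bracket (\<tau> s) n = 1"
    using ccw_parametrization_facts(2)[OF mink_ccw] minkowski_parametrization_facts(2)[OF mink(1)]
      lift_at[OF mink(2)] by (auto simp: n_def) metis
  \<comment> \<open>Since \<open>n\<close> has bracket 1 with \<open>\<tau> s\<close>, the factor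
    relating any other tangent to it is the bracket of that tangent.\<close>
  have parallel: "vector_derivative \<psi> (at (v s)) = bracket (\<tau> s) (vector_derivative \<psi> (at (v s))) *\<^sub>R n"
    if "ccw_parametrization F \<psi>" "tangent_lift I \<gamma> \<psi> v" for \<psi> v
    using gauge_curve_tangents_parallel[OF F _ _ n(1) ccw_parametrization_facts(2)[OF that(1)], of "v s"]
      ccw_parametrization_facts(1)[OF that(1)] ccw_parametrization_facts(1)[OF mink_ccw]
      lift_at[OF mink(2)] lift_at[OF that(2)] n(2)
    by simp

  have k_m: "minkowski_curvature F I \<gamma> s = bracket (\<tau> s) (\<gamma>2 s)"
  proof -
    have deriv: "(v has_real_derivative bracket (\<tau> s) (\<gamma>2 s)) (at s within I)"
      if "minkowski_parametrization F \<psi>" "tangent_lift I \<gamma> \<psi> v" for \<psi> v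
      using lift'[OF minkowski_parametrization_facts(1)[OF that(1)] that(2)]
        minkowski_parametrization_facts(2)[OF that(1), of "v s"] lift_at[OF that(2)] by simp
    show ?thesis
      unfolding minkowski_curvature_def
      by (rule the_equality) (use deriv mink ntriv[OF s] has_real_derivative_unique_within in blast)+
  qed

  have normal: "right_normal F I \<gamma> s = n"
  proof -
    have "m = n" if "minkowski_parametrization F \<psi>" "tangent_lift I \<gamma> \<psi> v"
      "(\<psi> has_vector_derivative m) (at (v s))" for \<psi> v m
      using parallel[OF minkowski_parametrization_facts(1)[OF that(1)] that(2)]
        minkowski_parametrization_facts(2)[OF that(1), of "v s"] lift_at[OF that(2)]
        vector_derivative_at[OF that(3)] by simp
    then show ?thesis
      unfolding right_normal_def by (intro the_equality) (use mink n in blast)+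
  qed

  have k_l: "arc_length_curvature F I \<gamma> s = F n * bracket (\<tau> s) (\<gamma>2 s)"
  proof -
    have deriv: "(v has_real_derivative F n * bracket (\<tau> s) (\<gamma>2 s)) (at s within I)"
      if "arc_length_parametrization F \<psi>" "tangent_lift I \<gamma> \<psi> v" for \<psi> v
    proof -
      define e where "e = vector_derivative \<psi> (at (v s))"
      have \<psi>: "ccw_parametrization F \<psi>" and e: "F e = 1"
        using that(1) by (auto simp: arc_length_parametrization_def e_def)
      have pos: "bracket (\<tau> s) e > 0"
        using ccw_parametrization_facts(5)[OF \<psi>, of "v s"] lift_at[OF that(2)] by (simp add: e_def)
      have "e = bracket (\<tau> s) e *\<^sub>R n"
        using parallel[OF \<psi> that(2)] by (simp add: e_def)
      \<comment> \<open>Counter-clockwise orientation makes the factor positive, so it can be taken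
        out of the asymmetric gauge.\<close>
      then have "1 = bracket (\<tau> s) e * F n"
        using e F pos unfolding gauge_fun_def by metis
      then have "bracket (\<tau> s) (\<gamma>2 s) / bracket (\<tau> s) e = F n * bracket (\<tau> s) (\<gamma>2 s)"
        using pos by (simp add: field_simps)
      then show ?thesis
        using lift'[OF \<psi> that(2)] lift_at[OF that(2)] by (simp add: e_def)
    qed
    obtain \<psi> v where "arc_length_parametrization F \<psi>" "tangent_lift I \<gamma> \<psi> v"
      using arc_length_parametrization_exists[OF assms(1,2)] lift_exists
      unfolding arc_length_parametrization_def by metis
    with deriv show ?thesis
      unfolding arc_length_curvature_def
      by (intro the_equality) (use ntriv[OF s] has_real_derivative_unique_within in blast)+
  qed

  show "arc_length_curvature F I \<gamma> s = F (right_normal F I \<gamma> s) * minkowski_curvature F I \<gamma> s"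
    by (simp add: k_l k_m normal)
qed

end
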